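(* There is no constant $C>1$ with the following property: for every integer $n\geq 2$ there exist $z_1,\ldots,z_n\in\mathbb C$ with $z_1=1$, $|z_j|\geq 1$ for $1\leq j\leq n$, and $$\max_{2\leq k\leq n+1}\left|\sum_{j=1}^n z_j^k\right|<C^{-n}.$$
   Context: The index $k$ in the maximum ranges over integers. *)

theory Defs
  imports "HOL-Analysis.Analysis"
begin

end

theory Submission
  imports Defs "HOL-Complex_Analysis.Complex_Analysis"
begin

text \<open>
  Suppose that such a \<open>C\<close> exists, and put \<open>\<epsilon> = C\<^sup>-\<^sup>n\<close>, \<open>m = n + 1\<close>. Attach to the numbers \<open>z\<^sub>j\<close> the
  polynomial \<open>P(x) = \<Prod>(1 - z\<^sub>j x)\<close> and let \<open>w = - \<Sum> z\<^sub>j\<close>, which a common rotation of the \<open>z\<^sub>j\<close>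
  makes nonnegative.

  By Newton's identities \<open>P(x) = exp(w x) H(x)\<close>, where \<open>H\<close> has constant term 1 and is driven by the
  power sums of index at least 2 alone. As these are at most \<open>\<epsilon>\<close> up to the index \<open>m\<close>, the coefficients
  of \<open>P\<close> up to \<open>x\<^sup>m\<close> agree with those of \<open>exp(w x)\<close> within a multiple of \<open>\<epsilon>\<close>
  (\<open>coeff_reciprocal_poly_approx\<close>). Since \<open>P\<close> has degree at most \<open>n < m\<close>, its coefficient of \<open>x\<^sup>m\<close>
  vanishes; hence \<open>w\<^sup>m / m!\<close> is exponentially small compared with \<open>exp w\<close>, which keeps \<open>w / m\<close> below
  a constant less than 1 (\<open>exponential_term_dominates\<close>). So the part of the exponential series beyond
  degree \<open>n\<close> is negligible even slightly outside the unit disc, and \<open>P(x) exp(-w x)\<close> tends to 1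
  uniformly for \<open>Re x \<ge> 1\<close>, \<open>|x| \<le> R\<close>, for a suitable \<open>R > 1\<close> (\<open>reciprocal_poly_close_to_exp\<close>).
  Passing to logarithmic derivatives, \<open>P'(x)/P(x) - w\<close> tends to 0 for real \<open>x\<close> in \<open>(1, R)\<close>
  (\<open>logarithmic_derivative_small\<close>).

  On the other hand all zeros \<open>1/z\<^sub>j\<close> of \<open>P\<close> lie in the closed unit disc, so \<open>(P'/P - w)/n\<close> is
  holomorphic for \<open>|x| > 1\<close>. In the variable \<open>y = 1/x\<close> these functions form a normal family on the
  unit disc; a limit of them vanishes on a real interval, hence everywhere. The values at \<open>y = 0\<close> and
  \<open>y = 1/2\<close> forbid this: they differ by the mean of \<open>(1/2) / (1 - (1/2)/z\<^sub>j)\<close>, whose real part is at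
  least 1/4 (\<open>resolvent_not_tends_to_constant\<close>). In other words, \<open>log |P|\<close> cannot be linear on an open
  set reaching outside the disc, because it grows like \<open>n log |x|\<close> at infinity.
\<close>

section \<open>Newton's identities\<close>

\<comment> \<open>The infix \<open>$\<close> is to denote coefficients of power series.\<close>
unbundle no vec_syntax

definition reciprocal_poly :: "('a \<Rightarrow> complex) \<Rightarrow> 'a set \<Rightarrow> complex poly" where
  "reciprocal_poly z A = (\<Prod>j\<in>A. [:1, - z j:])"

lemma poly_reciprocal_poly: "poly (reciprocal_poly z A) x = (\<Prod>j\<in>A. 1 - z j * x)"
  by (simp add: reciprocal_poly_def poly_prod mult.commute)

lemma coeff_reciprocal_poly_0: "coeff (reciprocal_poly z A) 0 = 1"
  by (simp add: poly_0_coeff_0 [symmetric] poly_reciprocal_poly)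

lemma coeff_reciprocal_poly_eq_0:
  assumes "finite A" "card A < k"
  shows "coeff (reciprocal_poly z A) k = 0"
proof -
  have "degree (reciprocal_poly z A) \<le> (\<Sum>j\<in>A. degree [:1, - z j:])"
    unfolding reciprocal_poly_def using degree_prod_sum_le [OF assms(1), of "\<lambda>j. [:1, - z j:]"]
    by (simp add: o_def del: degree_pCons_eq_if)
  also have "\<dots> \<le> (\<Sum>j\<in>A. 1)"
    by (intro sum_mono) simp
  finally show ?thesis
    using assms by (intro coeff_eq_0) simp
qed

lemma geometric_fps:
  "(1 - fps_const c * fps_X) * Abs_fps (\<lambda>k. if k = 0 then 0 else c ^ k) = fps_const (c::complex) * fps_X"
proof (rule fps_ext)
  fix n
  show "((1 - fps_const c * fps_X) * Abs_fps (\<lambda>k. if k = 0 then 0 else c ^ k)) $ n = (fps_const c * fps_X) $ n"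
    by (cases n) (auto simp: algebra_simps)
qed

text \<open>
  The logarithmic derivative turns the product into a sum over \<open>j\<close> of geometric series; comparing
  coefficients gives the usual recursion between elementary symmetric functions and power sums.
\<close>

lemma Newton_identities_fps:
  assumes "finite A"
  shows "fps_X * fps_deriv (fps_of_poly (reciprocal_poly z A)) =
         - (fps_of_poly (reciprocal_poly z A) * Abs_fps (\<lambda>k. if k = 0 then 0 else (\<Sum>j\<in>A. z j ^ k)))"
  using assms
proof induction
  case empty
  show ?case by (simp add: reciprocal_poly_def fps_eq_iff)
next
  case (insert a A)
  define F where "F = fps_of_poly (reciprocal_poly z A)"
  define f where "f = 1 - fps_const (z a) * fps_X"
  define S where "S = Abs_fps (\<lambda>k. if k = 0 then 0 else (\<Sum>j\<in>A. z j ^ k))"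
  define s where "s = Abs_fps (\<lambda>k. if k = 0 then 0 else z a ^ k)"
  have 1: "fps_of_poly (reciprocal_poly z (insert a A)) = f * F"
    using insert.hyps
    by (simp add: reciprocal_poly_def F_def f_def fps_of_poly_mult fps_of_poly_pCons
        flip: fps_const_neg)
  have 2: "Abs_fps (\<lambda>k. if k = 0 then 0 else (\<Sum>j\<in>insert a A. z j ^ k)) = s + S"
    using insert.hyps by (simp add: s_def S_def fps_eq_iff)
  have 3: "fps_X * fps_deriv f = - (f * s)"
    unfolding s_def f_def geometric_fps by (simp add: mult.commute)
  have 4: "fps_X * fps_deriv F = - (F * S)"
    using insert.IH by (simp add: F_def S_def)
  have "fps_X * fps_deriv (f * F) = (fps_X * fps_deriv f) * F + f * (fps_X * fps_deriv F)"
    by (simp add: algebra_simps)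
  also have "\<dots> = - (f * F * (s + S))"
    unfolding 3 4 by (simp add: algebra_simps)
  finally show ?case unfolding 1 2 .
qed

section \<open>Small power sums force exponential coefficients\<close>

text \<open>
  The equation says \<open>k h\<^sub>k = - \<Sum>\<^sub>i\<^sub><\<^sub>k h\<^sub>i T\<^sub>k\<^sub>-\<^sub>i\<close>. Inductively every \<open>h\<^sub>i\<close> has modulus at most 1, so the
  right-hand side is at most \<open>k \<epsilon>\<close>: the factor \<open>k\<close> absorbs the number of terms and no constant is lost.
\<close>

lemma exponential_cofactor_small:
  fixes H :: "complex fps"
  assumes H0: "H $ 0 = 1"
    and ode: "fps_X * fps_deriv H = - (H * T)"
    and T01: "T $ 0 = 0" "T $ 1 = 0"
    and T: "\<And>k. 2 \<le> k \<Longrightarrow> k \<le> m \<Longrightarrow> norm (T $ k) \<le> \<epsilon>"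
    and \<epsilon>: "0 \<le> \<epsilon>" "\<epsilon> \<le> 1"
    and k: "1 \<le> k" "k \<le> m"
  shows "norm (H $ k) \<le> \<epsilon>"
  using k
proof (induction k rule: less_induct)
  case (less k)
  have le1: "norm (H $ i) \<le> 1" if "i < k" for i
    using less.IH [of i] less.prems that H0 \<epsilon> by (cases "i = 0") force+
  have T': "norm (T $ i) \<le> \<epsilon>" if "i \<le> k" for i
    using that T [of i] T01 \<epsilon> less.prems by (cases "i = 0 \<or> i = 1") auto
  obtain l where l: "k = Suc l" using less.prems by (cases k) auto
  have "of_nat k * H $ k = (fps_X * fps_deriv H) $ k"
    by (simp add: l)
  also have "\<dots> = - (\<Sum>i=0..k. H $ i * T $ (k - i))"
    unfolding ode by (simp add: fps_mult_nth)
  also have "(\<Sum>i=0..k. H $ i * T $ (k - i)) = (\<Sum>i<k. H $ i * T $ (k - i))"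
    using T01 by (simp add: atLeast0AtMost lessThan_Suc_atMost [symmetric])
  finally have "real k * norm (H $ k) = norm (\<Sum>i<k. H $ i * T $ (k - i))"
    by (metis norm_minus_cancel norm_mult norm_of_nat)
  also have "\<dots> \<le> (\<Sum>i<k. 1 * \<epsilon>)"
    by (intro sum_norm_le order_trans [OF norm_mult_ineq] mult_mono le1 T') auto
  finally show ?case
    using less.prems by simp
qed

text \<open>
  Multiplying by \<open>exp(-w X)\<close> removes exactly the first power sum from Newton's identities, so the
  cofactor \<open>H\<close> is controlled by the small ones, and \<open>P = exp(w X) H\<close> is a small perturbation of
  \<open>exp(w X)\<close>, coefficient by coefficient.
\<close>

lemma coeff_reciprocal_poly_approx:
  fixes z :: "'a \<Rightarrow> complex"
  assumes A: "finite A"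
    and s: "\<And>k. 2 \<le> k \<Longrightarrow> k \<le> m \<Longrightarrow> norm (\<Sum>j\<in>A. z j ^ k) \<le> \<epsilon>"
    and \<epsilon>: "0 \<le> \<epsilon>" "\<epsilon> \<le> 1"
    and w: "w = - (\<Sum>j\<in>A. z j)"
    and k: "k \<le> m"
  shows "norm (w ^ k / fact k - coeff (reciprocal_poly z A) k) \<le> \<epsilon> * (\<Sum>j<k. norm w ^ j / fact j)"
proof -
  define P where "P = fps_of_poly (reciprocal_poly z A)"
  define S where "S = Abs_fps (\<lambda>k. if k = 0 then 0 else (\<Sum>j\<in>A. z j ^ k))"
  define H where "H = P * fps_exp (- w)"
  define T where "T = S + fps_const w * fps_X"
  have ode: "fps_X * fps_deriv H = - (H * T)"
  proof -
    have "fps_X * fps_deriv H = (fps_X * fps_deriv P) * fps_exp (- w) - fps_const w * fps_X * H"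
      by (simp add: H_def algebra_simps flip: fps_const_neg)
    also have "fps_X * fps_deriv P = - (P * S)"
      unfolding P_def S_def by (rule Newton_identities_fps [OF A])
    finally show ?thesis
      by (simp add: H_def T_def algebra_simps)
  qed
  have Hsmall: "norm (H $ i) \<le> \<epsilon>" if "1 \<le> i" "i \<le> m" for i
  proof (rule exponential_cofactor_small [OF _ ode])
    show "H $ 0 = 1"
      by (simp add: H_def P_def coeff_reciprocal_poly_0)
    show "T $ 0 = 0" "T $ 1 = 0"
      by (simp_all add: T_def S_def w)
    show "norm (T $ j) \<le> \<epsilon>" if "2 \<le> j" "j \<le> m" for j
      using s [OF that] that by (cases "j = 1") (auto simp: T_def S_def)
  qed (use \<epsilon> that in auto)
  have "P = H * fps_exp w"
    using fps_exp_add_mult [of w "- w"] by (simp add: H_def mult.assoc mult.commute)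
  then have "coeff (reciprocal_poly z A) k = (fps_exp w * H) $ k"
    by (metis P_def fps_of_poly_nth mult.commute)
  also have "\<dots> = (\<Sum>j=0..k. w ^ j / fact j * H $ (k - j))"
    by (simp add: fps_mult_nth)
  also have "\<dots> = (\<Sum>j<k. w ^ j / fact j * H $ (k - j)) + w ^ k / fact k"
    by (simp add: atLeast0AtMost lessThan_Suc_atMost [symmetric] H_def P_def coeff_reciprocal_poly_0)
  finally have "norm (w ^ k / fact k - coeff (reciprocal_poly z A) k)
                = norm (\<Sum>j<k. w ^ j / fact j * H $ (k - j))"
    by (simp add: norm_minus_commute)
  also have "\<dots> \<le> (\<Sum>j<k. norm w ^ j / fact j * \<epsilon>)"
    using k by (intro sum_norm_le order_trans [OF norm_mult_ineq] mult_mono Hsmall)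
               (auto simp: norm_divide norm_power)
  finally show ?thesis
    by (simp add: sum_distrib_left mult.commute)
qed

text \<open>
  If \<open>a \<ge> m / q\<close>, then stepping down from the \<open>m\<close>-th term of the exponential series to an earlier one
  gains a factor of at most \<open>q\<close> per step. The \<open>m\<close> terms below the \<open>m\<close>-th then sum to at most
  \<open>m q\<^sup>m\<close> times that term, too little when multiplied by \<open>\<epsilon>\<close>. This bounds the first power sum when
  applied at the first index where the polynomial has no coefficient left.
\<close>

lemma exponential_term_dominates:
  fixes a q \<epsilon> :: real
  assumes a: "0 \<le> a" and q: "1 \<le> q" and \<epsilon>: "0 \<le> \<epsilon>"
    and top_le: "a ^ m / fact m \<le> \<epsilon> * (\<Sum>j<m. a ^ j / fact j)"
    and small: "\<epsilon> * real m * q ^ m < 1" and m: "0 < m"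
  shows "a * q < real m"
proof (rule ccontr)
  assume "\<not> a * q < real m"
  then have aq: "real m \<le> a * q" by simp
  then have "a > 0"
    using m a by (cases "a = 0") auto
  have le: "a ^ j / fact j \<le> a ^ m / fact m * q ^ m" if "j < m" for j
  proof -
    have "fact m div fact j \<le> m ^ (m - j)"
      using fact_div_fact_le_pow [of "m - j" m] that by simp
    then have "(fact m :: nat) \<le> fact j * m ^ (m - j)"
      using that by (metis dvd_mult_div_cancel fact_dvd less_imp_le mult_le_mono2)
    then have "fact m \<le> fact j * real m ^ (m - j)"
      by (metis of_nat_fact of_nat_le_iff of_nat_mult of_nat_power)
    also have "\<dots> \<le> fact j * (a * q) ^ (m - j)"
      by (intro mult_left_mono power_mono aq) auto
    finally have "a ^ j * fact m \<le> a ^ j * (fact j * (a * q) ^ (m - j))"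
      using a by (intro mult_left_mono) auto
    also have "\<dots> = fact j * (a ^ m * q ^ (m - j))"
      using that by (simp add: power_mult_distrib flip: power_add)
    also have "\<dots> \<le> fact j * (a ^ m * q ^ m)"
      using a q by (intro mult_left_mono power_increasing) auto
    finally show ?thesis
      by (simp add: field_simps)
  qed
  have "a ^ m / fact m \<le> \<epsilon> * (\<Sum>j<m. a ^ m / fact m * q ^ m)"
    using top_le by (rule order_trans) (intro mult_left_mono sum_mono le \<epsilon>, auto)
  also have "\<dots> = (\<epsilon> * real m * q ^ m) * (a ^ m / fact m)"
    by simp
  also have "\<dots> < 1 * (a ^ m / fact m)"
    using small \<open>a > 0\<close> by (intro mult_strict_right_mono) auto
  finally show False by simp
qed


section \<open>Approximation outside the unit disc\<close>

text \<open>
  Below the index \<open>m\<close> the difference of the two series has coefficients at most \<open>B\<close>. From \<open>m\<close> on it is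
  the tail of the exponential series, whose terms at radius \<open>R\<close> shrink by a factor \<open>|w| R / k \<le> 1 / R\<close>
  per step. The factor \<open>R\<^sup>2\<close>, rather than \<open>R\<close>, in the bound on \<open>w\<close> is what makes this geometric.
\<close>

lemma exp_minus_poly_bound:
  fixes p :: "complex poly" and w x :: complex and B R :: real
  assumes R: "1 < R" and x: "norm x \<le> R" and w: "norm w * R\<^sup>2 \<le> real m"
    and B: "\<And>k. k \<le> m \<Longrightarrow> norm (w ^ k / fact k - coeff p k) \<le> B"
    and p: "degree p < m"
  shows "norm (exp (w * x) - poly p x) \<le> B * R ^ m * (real m + R / (R - 1))"
proof -
  define d where "d k = w ^ k / fact k - coeff p k" for k
  define g where "g k = (if k < m then B * R ^ m else B * R ^ m * (1 / R) ^ (k - m))" for k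
  have "norm (d 0) \<le> B" unfolding d_def by (intro B) simp
  then have B0: "0 \<le> B" by (rule order_trans [OF norm_ge_zero])
  have dR: "norm (d k) * R ^ k \<le> g k" for k
  proof (cases "k < m")
    case True
    have "norm (d k) * R ^ k \<le> B * R ^ m"
      using B [of k] True R B0 by (intro mult_mono power_increasing) (auto simp: d_def)
    with True show ?thesis by (simp add: g_def)
  next
    case False
    then have "m \<le> k" by simp
    then show ?thesis
    proof (induction k rule: dec_induct)
      case base
      have "norm (d m) * R ^ m \<le> B * R ^ m"
        using B [of m] R by (intro mult_right_mono) (auto simp: d_def)
      then show ?case by (simp add: g_def)
    next
      case (step k)
      have d_tail: "d i = w ^ i / fact i" if "i \<ge> m" for i
        using that p by (simp add: d_def coeff_eq_0)
      have "norm w * R\<^sup>2 \<le> real (Suc k)"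
        using w step.hyps by simp
      then have ratio: "norm w * R / real (Suc k) \<le> 1 / R"
        using R by (simp add: field_simps power2_eq_square)
      have "d (Suc k) = w / of_nat (Suc k) * d k"
        using step.hyps by (simp add: d_tail)
      then have "norm (d (Suc k)) * R ^ Suc k = (norm w * R / real (Suc k)) * (norm (d k) * R ^ k)"
        by (simp add: norm_mult norm_divide del: of_nat_Suc)
      also have "\<dots> \<le> (1 / R) * g k"
        using R by (intro mult_mono ratio step.IH) auto
      also have "\<dots> = g (Suc k)"
        using step.hyps by (simp add: g_def Suc_diff_le)
      finally show ?case .
    qed
  qed
  have "(\<lambda>k. w ^ k * x ^ k / fact k) sums exp (w * x)"
    using exp_converges [of "w * x"]
    by (simp add: power_mult_distrib scaleR_conv_of_real field_simps)
  moreover have "(\<lambda>k. coeff p k * x ^ k) sums poly p x"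
    unfolding poly_altdef by (rule sums_finite) (auto simp: coeff_eq_0)
  ultimately have "(\<lambda>k. w ^ k * x ^ k / fact k - coeff p k * x ^ k) sums (exp (w * x) - poly p x)"
    by (rule sums_diff)
  then have f_sums: "(\<lambda>k. d k * x ^ k) sums (exp (w * x) - poly p x)"
    by (simp add: d_def algebra_simps)
  have "(\<lambda>i. B * R ^ m * (1 / R) ^ i) sums (B * R ^ m * (1 / (1 - 1 / R)))"
    using R by (intro sums_mult geometric_sums) simp
  then have "(\<lambda>i. g (i + m)) sums (B * R ^ m * (1 / (1 - 1 / R)))"
    by (simp add: g_def)
  then have "g sums (B * R ^ m * (1 / (1 - 1 / R)) + (\<Sum>i<m. g i))"
    by (simp add: sums_iff_shift)
  also have "B * R ^ m * (1 / (1 - 1 / R)) + (\<Sum>i<m. g i) = B * R ^ m * (real m + R / (R - 1))"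
    using R by (simp add: g_def field_simps)
  finally have g_sums: "g sums (B * R ^ m * (real m + R / (R - 1)))" .
  have "norm (d k * x ^ k) \<le> g k" for k
  proof -
    have "norm (d k * x ^ k) \<le> norm (d k) * R ^ k"
      using x by (auto simp: norm_mult norm_power intro!: mult_left_mono power_mono)
    with dR show ?thesis by (rule order_trans [rotated])
  qed
  with f_sums g_sums show ?thesis by (rule norm_sums_le)
qed

text \<open>
  The absolute error is of the order \<open>\<epsilon> exp a\<close>. Restricting to \<open>Re x \<ge> 1\<close> ensures
  \<open>|exp(a x)| \<ge> exp a\<close>, so that it is also a relative error of the order \<open>\<epsilon>\<close>.
\<close>

lemma reciprocal_poly_close_to_exp:
  fixes z :: "'a \<Rightarrow> complex" and A :: "'a set" and a R \<epsilon> :: real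
  defines "m \<equiv> card A + 1"
  assumes A: "finite A"
    and s: "\<And>k. 2 \<le> k \<Longrightarrow> k \<le> m \<Longrightarrow> norm (\<Sum>j\<in>A. z j ^ k) \<le> \<epsilon>"
    and \<epsilon>: "0 \<le> \<epsilon>" "\<epsilon> \<le> 1"
    and a: "(\<Sum>j\<in>A. z j) = - of_real a" "0 \<le> a"
    and R: "1 < R" and small: "\<epsilon> * real m * (R\<^sup>2) ^ m < 1"
  shows "a \<le> real m"
    and "\<And>x. 1 \<le> Re x \<Longrightarrow> norm x \<le> R \<Longrightarrow>
           norm (exp (- of_real a * x) * poly (reciprocal_poly z A) x - 1)
             \<le> \<epsilon> * R ^ m * (real m + R / (R - 1))"
proof -
  define p where "p = reciprocal_poly z A"
  have near: "norm (of_real a ^ k / fact k - coeff p k) \<le> \<epsilon> * (\<Sum>j<k. a ^ j / fact j)" if "k \<le> m" for k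
    using coeff_reciprocal_poly_approx [OF A s \<epsilon> _ that, of "of_real a"] a by (simp add: p_def)
  have pm: "coeff p k = 0" if "k \<ge> m" for k
    using that A by (simp add: p_def m_def coeff_reciprocal_poly_eq_0)
  have "a ^ m / fact m \<le> \<epsilon> * (\<Sum>j<m. a ^ j / fact j)"
    using near [of m] a pm [of m] by (simp add: norm_divide norm_power)
  then have aR: "a * R\<^sup>2 < real m"
    using a(2) R \<epsilon> small by (intro exponential_term_dominates [where \<epsilon> = \<epsilon>]) (auto simp: m_def)
  have "a * 1 \<le> a * R\<^sup>2"
    using a(2) R by (intro mult_left_mono) auto
  with aR show "a \<le> real m" by simp
  have partial: "(\<Sum>j<k. a ^ j / fact j) \<le> exp a" for k
  proof -
    have "(\<lambda>j. a ^ j / fact j) sums exp a"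
      using exp_converges [of a] by (simp add: divide_inverse mult.commute)
    then show ?thesis
      using a(2) by (metis (no_types, lifting) divide_nonneg_pos fact_gt_zero finite_lessThan
          sum_le_suminf sums_iff zero_le_power)
  qed
  have coeffs: "norm (of_real a ^ k / fact k - coeff p k) \<le> \<epsilon> * exp a" if "k \<le> m" for k
    using near [OF that] partial \<epsilon> by (meson mult_left_mono order_trans)
  have deg: "degree p < m"
    using pm coeff_reciprocal_poly_0 [of z A] by (metis leading_coeff_0_iff not_less p_def coeff_0 zero_neq_one)
  fix x :: complex assume x: "1 \<le> Re x" "norm x \<le> R"
  have "norm (exp (of_real a * x) - poly p x) \<le> \<epsilon> * exp a * R ^ m * (real m + R / (R - 1))"
    by (rule exp_minus_poly_bound [OF R x(2) _ coeffs deg]) (use aR a in auto)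
  moreover have "exp (- of_real a * x) * poly p x - 1 = - exp (- of_real a * x) * (exp (of_real a * x) - poly p x)"
    by (simp add: algebra_simps flip: exp_add)
  ultimately have "norm (exp (- of_real a * x) * poly p x - 1)
     \<le> exp (- a * Re x) * (\<epsilon> * exp a * R ^ m * (real m + R / (R - 1)))"
    by (simp add: norm_mult mult_left_mono)
  also have "\<dots> = exp (a - a * Re x) * (\<epsilon> * R ^ m * (real m + R / (R - 1)))"
    by (simp add: exp_diff exp_minus field_simps)
  also have "\<dots> \<le> 1 * (\<epsilon> * R ^ m * (real m + R / (R - 1)))"
    using a(2) x(1) R \<epsilon> by (intro mult_right_mono) (auto simp: mult_le_cancel_left1)
  finally show "norm (exp (- of_real a * x) * poly (reciprocal_poly z A) x - 1)
             \<le> \<epsilon> * R ^ m * (real m + R / (R - 1))"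
    by (simp add: p_def)
qed

text \<open>
  With \<open>Q(u) = exp(-w u) P(u) - 1\<close> the derivative of \<open>Q\<close> is \<open>Q + 1\<close> times \<open>P'/P - w\<close>; Cauchy's
  estimate on a disc of radius \<open>r\<close> makes it small, and \<open>|Q + 1| \<ge> 1/2\<close>. The logarithmic derivative is
  written in the variable \<open>y = 1/t\<close>, in which it is holomorphic on the unit disc.
\<close>

lemma logarithmic_derivative_small:
  fixes z :: "'a \<Rightarrow> complex" and w :: complex and t r R \<eta> :: real
  assumes A: "finite A" and z: "\<And>j. j \<in> A \<Longrightarrow> norm (z j) \<ge> 1"
    and close: "\<And>x. 1 \<le> Re x \<Longrightarrow> norm x \<le> R \<Longrightarrow> norm (exp (- w * x) * poly (reciprocal_poly z A) x - 1) \<le> \<eta>"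
    and \<eta>: "\<eta> \<le> 1 / 2" and r: "0 < r" "1 \<le> t - r" "t + r \<le> R"
  shows "norm ((\<Sum>j\<in>A. (1 / of_real t) / (1 - (1 / of_real t) / z j)) - w) \<le> 2 * \<eta> / r"
proof -
  define x :: complex where "x = of_real t"
  define Q where "Q u = exp (- w * u) * poly (reciprocal_poly z A) u - 1" for u
  define D where "D = (\<Sum>j\<in>A. (1 / x) / (1 - (1 / x) / z j)) - w"
  have t: "1 < t" using r by simp
  have zx: "1 - z j * x \<noteq> 0" if "j \<in> A" for j
  proof
    assume "1 - z j * x = 0"
    then have "norm (z j) * t = 1"
      using t by (metis abs_of_pos eq_iff_diff_eq_0 less_trans norm_mult norm_of_real norm_one x_def zero_less_one)
    moreover have "1 * t \<le> norm (z j) * t"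
      using z [OF that] t by (intro mult_right_mono) auto
    ultimately show False using t by simp
  qed
  have summand: "- z j / (1 - z j * x) = (1 / x) / (1 - (1 / x) / z j)" if "j \<in> A" for j
  proof -
    have "z j \<noteq> 0" "x \<noteq> 0" using z [OF that] t by (auto simp: x_def)
    moreover have "x * z j - 1 \<noteq> 0" "1 - x * z j \<noteq> 0" using zx [OF that] by (auto simp: mult.commute)
    ultimately show ?thesis by (simp add: field_simps)
  qed
  have "((\<lambda>u. \<Prod>j\<in>A. 1 - z j * u) has_field_derivative
          (\<Prod>j\<in>A. 1 - z j * x) * (\<Sum>j\<in>A. - z j / (1 - z j * x))) (at x)"
    using zx by (intro has_field_derivative_prod') (auto intro!: derivative_eq_intros)
  also have "(\<Sum>j\<in>A. - z j / (1 - z j * x)) = D + w"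
    unfolding D_def using sum.cong [OF refl summand, of A] by simp
  finally have "(Q has_field_derivative (Q x + 1) * D) (at x)"
    unfolding Q_def poly_reciprocal_poly
    by (auto intro!: derivative_eq_intros simp: algebra_simps)
  then have deriv: "deriv Q x = (Q x + 1) * D"
    by (rule DERIV_imp_deriv)
  have Qle: "norm (Q u) \<le> \<eta>" if "norm (x - u) \<le> r" for u
    unfolding Q_def
  proof (rule close)
    have "\<bar>t - Re u\<bar> \<le> norm (x - u)"
      using abs_Re_le_cmod [of "x - u"] by (simp add: x_def)
    then show "1 \<le> Re u" using that r by linarith
    have "norm u \<le> norm x + norm (x - u)"
      by (metis add.commute norm_minus_commute norm_triangle_sub)
    then show "norm u \<le> R" using that r t by (simp add: x_def)
  qed
  have holQ: "Q holomorphic_on UNIV"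
    unfolding Q_def by (intro holomorphic_intros)
  have "norm ((deriv ^^ 1) Q x) \<le> fact 1 * \<eta> / r ^ 1"
  proof (rule Cauchy_inequality)
    show "Q holomorphic_on ball x r" "continuous_on (cball x r) Q"
      using holQ by (auto intro: holomorphic_on_subset holomorphic_on_imp_continuous_on)
  qed (use r Qle in auto)
  then have *: "norm (Q x + 1) * norm D \<le> \<eta> / r"
    by (simp add: deriv norm_mult)
  have "1 / 2 \<le> norm (Q x + 1)"
    using Qle [of x] r \<eta> norm_triangle_ineq2 [of 1 "- Q x"] by (simp add: add.commute)
  then have "1 / 2 * norm D \<le> norm (Q x + 1) * norm D"
    by (intro mult_right_mono) auto
  with * show ?thesis
    by (simp add: D_def x_def)
qed

section \<open>Normal families\<close>

text \<open>
  The map \<open>v \<mapsto> 1 / (1 - v)\<close> takes the unit disc onto the half-plane to the right of \<open>1/2\<close>.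
\<close>

lemma Re_inverse_one_minus:
  assumes "norm (v::complex) < 1"
  shows "1 / 2 \<le> Re (1 / (1 - v))"
proof -
  have "(Re v)\<^sup>2 + (Im v)\<^sup>2 < 1"
    using assms by (simp add: cmod_def)
  moreover have "Re v < 1"
    using assms complex_Re_le_cmod [of v] by linarith
  then have "(1 - Re v)\<^sup>2 + (Im v)\<^sup>2 > 0"
    by (intro add_pos_nonneg) auto
  ultimately show ?thesis
    by (simp add: Re_divide field_simps power2_eq_square)
qed

text \<open>
  Averages of the resolvents \<open>y / (1 - y / z\<^sub>j)\<close> are locally bounded on the unit disc, vanish at 0
  and are bounded away from 0 at \<open>1/2\<close>. By Montel's theorem and the identity theorem their distance
  from constants cannot tend to 0 on a real interval, since a limit function would then be constant.
\<close>

lemma resolvent_not_tends_to_constant: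
  fixes z :: "nat \<Rightarrow> 'a \<Rightarrow> complex" and w :: "nat \<Rightarrow> complex" and M \<rho> :: real
  assumes A: "\<And>n. finite (A n)" "\<And>n. A n \<noteq> {}"
    and z: "\<And>n j. j \<in> A n \<Longrightarrow> norm (z n j) \<ge> 1"
    and w: "\<And>n. norm (w n) \<le> M * card (A n)"
    and \<rho>: "0 \<le> \<rho>" "\<rho> < 1"
    and lim: "\<And>t. \<rho> < t \<Longrightarrow> t < 1 \<Longrightarrow>
       (\<lambda>n. ((\<Sum>j\<in>A n. of_real t / (1 - of_real t / z n j)) - w n) / of_nat (card (A n))) \<longlonglongrightarrow> 0"
  shows False
proof -
  define F where "F n y = ((\<Sum>j\<in>A n. y / (1 - y / z n j)) - w n) / of_nat (card (A n))" for n y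
  have card: "card (A n) > 0" for n
    using A by (simp add: card_gt_0_iff)
  have quot: "norm (y / z n j) \<le> norm y" if "j \<in> A n" for n j y
    using z [OF that] by (simp add: norm_divide divide_le_eq mult_le_cancel_left1)
  have hol: "F n holomorphic_on ball 0 1" for n
  proof -
    have "1 - y / z n j \<noteq> 0" if "j \<in> A n" "y \<in> ball 0 1" for j y
      using quot [OF that(1), of y] that(2) by auto
    then show ?thesis
      unfolding F_def using z card [of n] by (intro holomorphic_intros) force+
  qed
  have bound: "norm (F n y) \<le> 1 / (1 - r) + M" if "norm y \<le> r" "r < 1" for n y r
  proof -
    have "norm (\<Sum>j\<in>A n. y / (1 - y / z n j)) \<le> (\<Sum>j\<in>A n. 1 / (1 - r))"
    proof (rule sum_norm_le)
      fix j assume "j \<in> A n"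
      have "1 - r \<le> norm (1 - y / z n j)"
        using norm_triangle_ineq2 [of 1 "y / z n j"] quot [OF \<open>j \<in> A n\<close>, of y] that by simp
      then show "norm (y / (1 - y / z n j)) \<le> 1 / (1 - r)"
        unfolding norm_divide using that by (intro frac_le) auto
    qed
    then have "norm ((\<Sum>j\<in>A n. y / (1 - y / z n j)) - w n) \<le> card (A n) * (1 / (1 - r) + M)"
      using norm_triangle_ineq4 [of "\<Sum>j\<in>A n. y / (1 - y / z n j)" "w n"] w [of n]
      by (simp add: algebra_simps)
    then show ?thesis
      using card [of n] by (simp add: F_def norm_divide divide_le_eq mult.commute)
  qed
  obtain g r where g: "g holomorphic_on ball 0 1" and r: "strict_mono (r :: nat \<Rightarrow> nat)"
    and conv: "\<And>y. y \<in> ball 0 1 \<Longrightarrow> (\<lambda>n. F (r n) y) \<longlonglongrightarrow> g y"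
  proof (rule Montel [of "ball 0 1" "range F" F])
    show "\<exists>B. \<forall>h\<in>range F. \<forall>y\<in>K. norm (h y) \<le> B" if K: "compact K" "K \<subseteq> ball 0 1" for K
    proof (cases "K = {}")
      case False
      obtain k where "k \<in> K" "\<And>y. y \<in> K \<Longrightarrow> norm y \<le> norm k"
        using continuous_attains_sup [OF K(1) False, of norm] by (auto intro: continuous_intros)
      with K(2) show ?thesis
        by (intro exI [of _ "1 / (1 - norm k) + M"]) (auto intro!: bound)
    qed auto
  qed (use hol in auto)
  have zero: "g y = 0" if "y \<in> of_real ` {\<rho><..<1}" for y
  proof -
    obtain t where t: "y = of_real t" "\<rho> < t" "t < 1" using \<open>y \<in> _\<close> by auto
    have "(\<lambda>n. F (r n) y) \<longlonglongrightarrow> 0"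
      using LIMSEQ_subseq_LIMSEQ [OF lim [OF t(2,3)] r] by (simp add: F_def t(1) o_def)
    moreover have "(\<lambda>n. F (r n) y) \<longlonglongrightarrow> g y"
      using t \<rho> by (intro conv) auto
    ultimately show ?thesis by (rule LIMSEQ_unique [symmetric])
  qed
  define \<xi> where "\<xi> = (\<rho> + 1) / 2"
  have g0: "g y = 0" if "y \<in> ball 0 1" for y
  proof (rule analytic_continuation [OF g, of "of_real ` {\<rho><..<1}" "of_real \<xi>"])
    have "\<xi> islimpt {\<rho><..<1}"
      using \<rho> by (intro open_imp_islimpt) (auto simp: \<xi>_def)
    then show "complex_of_real \<xi> islimpt of_real ` {\<rho><..<1}"
      unfolding islimpt_approachable by (metis dist_of_real imageI of_real_eq_iff)
  qed (use \<rho> zero that in \<open>auto simp: \<xi>_def\<close>)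
  have "(\<lambda>n. F (r n) (1/2) - F (r n) 0) \<longlonglongrightarrow> 0 - 0"
    using conv [of "1/2"] conv [of 0] g0 [of "1/2"] g0 [of 0] by (intro tendsto_diff) auto
  then have "(\<lambda>n. Re (F (r n) (1/2) - F (r n) 0)) \<longlonglongrightarrow> Re (0 - 0)"
    by (rule tendsto_Re)
  moreover have "1 / 4 \<le> Re (F n (1/2) - F n 0)" for n
  proof -
    have half: "Re ((1/2) / u) = Re (1 / u) / 2" for u
      by (metis Re_divide_numeral divide_divide_eq_left mult.commute)
    have "card (A n) * (1 / 4) \<le> (\<Sum>j\<in>A n. Re ((1/2) / (1 - (1/2) / z n j)))"
    proof (rule sum_bounded_below)
      fix j assume "j \<in> A n"
      then have "norm ((1/2) / z n j) < 1"
        using quot [of j n "1/2"] by simp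
      then show "1 / 4 \<le> Re ((1/2) / (1 - (1/2) / z n j))"
        using Re_inverse_one_minus [of "(1/2) / z n j"] half [of "1 - (1/2) / z n j"] by linarith
    qed
    moreover have "F n (1/2) - F n 0 = (\<Sum>j\<in>A n. (1/2) / (1 - (1/2) / z n j)) / of_nat (card (A n))"
      by (simp add: F_def diff_divide_distrib)
    ultimately show ?thesis
      using card [of n] by (simp add: le_divide_eq mult.commute)
  qed
  ultimately have "1 / 4 \<le> Re (0 - 0)"
    by (intro LIMSEQ_le_const [of _ _ "1/4"]) auto
  then show False by simp
qed

section \<open>The lower bound for power sums\<close>

lemma rotate_to_negative_sum:
  fixes z :: "'a \<Rightarrow> complex"
  obtains u where "norm u = 1" "(\<Sum>j\<in>A. u * z j) = - of_real (norm (\<Sum>j\<in>A. z j))"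
proof
  define S where "S = (\<Sum>j\<in>A. z j)"
  show "norm (- cis (- Arg S)) = 1" by simp
  have "cis (- Arg S) * S = cis (- Arg S) * (of_real (norm S) * cis (Arg S))"
    by (metis rcis_cmod_Arg rcis_def)
  also have "\<dots> = of_real (norm S)"
    by (simp add: cis_mult mult.left_commute)
  finally show "(\<Sum>j\<in>A. - cis (- Arg S) * z j) = - of_real (norm (\<Sum>j\<in>A. z j))"
    by (simp add: S_def sum_distrib_left sum_negf)
qed

theorem corollary1p2:
  shows "\<not> (\<exists>C::real. C > 1 \<and>
           (\<forall>n::nat. n \<ge> 2 \<longrightarrow>
             (\<exists>z::nat \<Rightarrow> complex.
                z 1 = 1 \<and> (\<forall>j\<in>{1..n}. norm (z j) \<ge> 1) \<and>
                (MAX k\<in>{2..n+1}. norm (\<Sum>j=1..n. z j ^ k)) < C powi (- int n))))"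
proof
  assume "\<exists>C::real. C > 1 \<and>
           (\<forall>n::nat. n \<ge> 2 \<longrightarrow>
             (\<exists>z::nat \<Rightarrow> complex.
                z 1 = 1 \<and> (\<forall>j\<in>{1..n}. norm (z j) \<ge> 1) \<and>
                (MAX k\<in>{2..n+1}. norm (\<Sum>j=1..n. z j ^ k)) < C powi (- int n)))"
  then obtain C :: real where C: "C > 1"
    and ex: "\<And>n. n \<ge> 2 \<Longrightarrow> \<exists>z::nat \<Rightarrow> complex. z 1 = 1 \<and> (\<forall>j\<in>{1..n}. norm (z j) \<ge> 1) \<and>
                (MAX k\<in>{2..n+1}. norm (\<Sum>j=1..n. z j ^ k)) < C powi (- int n)"
    by blast
  \<comment> \<open>The fourth root leaves room for the two losses \<open>(R\<^sup>2)\<^sup>m\<close> and \<open>R\<^sup>m\<close> against \<open>C\<^sup>-\<^sup>n = R\<^sup>-\<^sup>4\<^sup>n\<close>.\<close>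
  define R where "R = root 4 C"
  have R: "1 < R" and R4: "R ^ 4 = C"
    using C by (simp_all add: R_def)
  define \<epsilon> where "\<epsilon> n = (1 / R ^ 4) ^ n" for n :: nat
  have \<epsilon>: "0 \<le> \<epsilon> n" "\<epsilon> n \<le> 1" for n
    using R by (auto simp: \<epsilon>_def intro!: power_le_one)
  have "\<exists>z a. 0 \<le> a \<and> (\<Sum>j=1..n. z j) = - complex_of_real a \<and> (\<forall>j\<in>{1..n}. norm (z j) \<ge> 1) \<and>
          (\<forall>k. 2 \<le> k \<longrightarrow> k \<le> n + 1 \<longrightarrow> norm (\<Sum>j=1..n. z j ^ k) \<le> \<epsilon> n)" if n: "n \<ge> 2" for n
  proof -
    obtain z :: "nat \<Rightarrow> complex" where z: "\<And>j. j \<in> {1..n} \<Longrightarrow> norm (z j) \<ge> 1"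
      and max: "(MAX k\<in>{2..n+1}. norm (\<Sum>j=1..n. z j ^ k)) < C powi (- int n)"
      using ex [OF n] by blast
    obtain u where u: "norm u = 1" "(\<Sum>j=1..n. u * z j) = - of_real (norm (\<Sum>j=1..n. z j))"
      by (rule rotate_to_negative_sum)
    have "norm (\<Sum>j=1..n. (u * z j) ^ k) \<le> \<epsilon> n" if "2 \<le> k" "k \<le> n + 1" for k
    proof -
      have "norm (\<Sum>j=1..n. (u * z j) ^ k) = norm (\<Sum>j=1..n. z j ^ k)"
        using u(1) by (simp add: power_mult_distrib norm_mult norm_power flip: sum_distrib_left)
      also have "\<dots> \<le> (MAX k\<in>{2..n+1}. norm (\<Sum>j=1..n. z j ^ k))"
        using that by (intro Max_ge) auto
      also have "\<dots> \<le> C powi (- int n)"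
        using max by simp
      also have "\<dots> = \<epsilon> n"
        by (simp add: \<epsilon>_def R4 power_int_minus field_simps)
      finally show ?thesis .
    qed
    with u z show ?thesis
      by (intro exI [of _ "\<lambda>j. u * z j"] exI [of _ "norm (\<Sum>j=1..n. z j)"]) (auto simp: norm_mult)
  qed
  then obtain z :: "nat \<Rightarrow> nat \<Rightarrow> complex" and a :: "nat \<Rightarrow> real"
    where za: "\<And>n. n \<ge> 2 \<Longrightarrow> 0 \<le> a n \<and> (\<Sum>j=1..n. z n j) = - complex_of_real (a n) \<and>
          (\<forall>j\<in>{1..n}. norm (z n j) \<ge> 1) \<and>
          (\<forall>k. 2 \<le> k \<longrightarrow> k \<le> n + 1 \<longrightarrow> norm (\<Sum>j=1..n. z n j ^ k) \<le> \<epsilon> n)"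
    by metis
  \<comment> \<open>\<open>\<delta>\<close> controls the size of the first power sum, \<open>\<eta>\<close> the distance of \<open>P(x) exp(-a x)\<close> from 1.\<close>
  define \<delta> where "\<delta> n = \<epsilon> n * real (n + 1) * (R\<^sup>2) ^ (n + 1)" for n
  define \<eta> where "\<eta> n = \<epsilon> n * R ^ (n + 1) * (real (n + 1) + R / (R - 1))" for n
  have geometric: "(\<lambda>n. (real (n + 1) + c) * q ^ n) \<longlonglongrightarrow> 0" if "0 \<le> q" "q < 1" for q c :: real
  proof -
    have "(\<lambda>n. real n * q ^ n + (1 + c) * q ^ n) \<longlonglongrightarrow> 0 + (1 + c) * 0"
      using that by (intro tendsto_add tendsto_mult tendsto_const powser_times_n_limit_0 LIMSEQ_power_zero) auto
    then show ?thesis by (simp add: algebra_simps)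
  qed
  have \<delta>0: "\<delta> \<longlonglongrightarrow> 0"
  proof -
    have eq: "\<delta> n = R\<^sup>2 * ((real (n + 1) + 0) * (1 / R\<^sup>2) ^ n)" for n
    proof -
      have "\<epsilon> n * (R\<^sup>2) ^ n = (1 / R\<^sup>2) ^ n"
        unfolding \<epsilon>_def using R
        by (subst power_mult_distrib [symmetric]) (simp add: power2_eq_square power4_eq_xxxx)
      then show ?thesis by (simp add: \<delta>_def algebra_simps)
    qed
    have "(\<lambda>n. R\<^sup>2 * ((real (n + 1) + 0) * (1 / R\<^sup>2) ^ n)) \<longlonglongrightarrow> R\<^sup>2 * 0"
      using R by (intro tendsto_mult tendsto_const geometric) (auto simp: divide_less_eq)
    then show ?thesis by (simp add: eq [abs_def])
  qed
  have \<eta>0: "\<eta> \<longlonglongrightarrow> 0"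
  proof -
    have eq: "\<eta> n = R * ((real (n + 1) + R / (R - 1)) * (1 / R ^ 3) ^ n)" for n
    proof -
      have "\<epsilon> n * R ^ n = (1 / R ^ 3) ^ n"
        unfolding \<epsilon>_def using R
        by (subst power_mult_distrib [symmetric]) (simp add: power3_eq_cube power4_eq_xxxx)
      then show ?thesis by (simp add: \<eta>_def algebra_simps)
    qed
    have "(\<lambda>n. R * ((real (n + 1) + R / (R - 1)) * (1 / R ^ 3) ^ n)) \<longlonglongrightarrow> R * 0"
      using R by (intro tendsto_mult tendsto_const geometric) (auto simp: divide_less_eq)
    then show ?thesis by (simp add: eq [abs_def])
  qed
  have "eventually (\<lambda>n. \<delta> n < 1 \<and> \<eta> n < 1 / 2) sequentially"
    using order_tendstoD(2) [OF \<delta>0, of 1] order_tendstoD(2) [OF \<eta>0, of "1 / 2"]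
    by (auto intro: eventually_conj)
  then obtain N0 where N0: "\<And>n. n \<ge> N0 \<Longrightarrow> \<delta> n < 1 \<and> \<eta> n < 1 / 2"
    by (auto simp: eventually_sequentially)
  define N where "N = N0 + 2"
  show False
  proof (rule resolvent_not_tends_to_constant
      [of "\<lambda>n. {1..n + N}" "\<lambda>n. z (n + N)" "\<lambda>n. of_real (a (n + N))" 2 "1 / R"])
    fix n :: nat
    let ?n = "n + N"
    have n: "?n \<ge> 2" "?n \<ge> N0" by (auto simp: N_def)
    note Z = za [OF n(1)]
    show "{1..?n} \<noteq> {}" using n by auto
    show "norm (z ?n j) \<ge> 1" if "j \<in> {1..?n}" for j
      using Z that by blast
    have small: "\<epsilon> ?n * real (card {1..?n} + 1) * (R\<^sup>2) ^ (card {1..?n} + 1) < 1"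
      using N0 [OF n(2)] by (simp add: \<delta>_def)
    have "a ?n \<le> real (card {1..?n} + 1)"
      by (rule reciprocal_poly_close_to_exp(1) [OF _ _ \<epsilon> _ _ R small, where z = "z ?n"]) (use Z in auto)
    then show "norm (complex_of_real (a ?n)) \<le> 2 * real (card {1..?n})"
      using Z n by simp
  next
    fix t :: real assume t: "1 / R < t" "t < 1"
    define x where "x = 1 / t"
    define r where "r = min (x - 1) (R - x)"
    have "0 < 1 / R" using R by simp
    with t have t0: "0 < t" by linarith
    have x: "1 < x" "x < R"
      using t t0 R by (auto simp: x_def field_simps)
    have r: "0 < r" "1 \<le> x - r" "x + r \<le> R"
      using x by (auto simp: r_def)
    have bound: "norm (((\<Sum>j\<in>{1..n + N}. of_real t / (1 - of_real t / z (n + N) j)) - of_real (a (n + N)))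
             / of_nat (card {1..n + N})) \<le> 2 * \<eta> (n + N) / r" for n
    proof -
      let ?n = "n + N"
      have n: "?n \<ge> 2" "?n \<ge> N0" by (auto simp: N_def)
      note Z = za [OF n(1)]
      have small: "\<epsilon> ?n * real (card {1..?n} + 1) * (R\<^sup>2) ^ (card {1..?n} + 1) < 1"
        using N0 [OF n(2)] by (simp add: \<delta>_def)
      have close: "norm (exp (- of_real (a ?n) * y) * poly (reciprocal_poly (z ?n) {1..?n}) y - 1) \<le> \<eta> ?n"
        if "1 \<le> Re y" "norm y \<le> R" for y
      proof -
        have "norm (exp (- of_real (a ?n) * y) * poly (reciprocal_poly (z ?n) {1..?n}) y - 1)
           \<le> \<epsilon> ?n * R ^ (card {1..?n} + 1) * (real (card {1..?n} + 1) + R / (R - 1))"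
          by (rule reciprocal_poly_close_to_exp(2) [OF _ _ \<epsilon> _ _ R small that]) (use Z in auto)
        then show ?thesis by (simp add: \<eta>_def)
      qed
      define D where "D = (\<Sum>j\<in>{1..?n}. of_real t / (1 - of_real t / z ?n j)) - complex_of_real (a ?n)"
      have "norm ((\<Sum>j\<in>{1..?n}. (1 / of_real x) / (1 - (1 / of_real x) / z ?n j)) - of_real (a ?n))
          \<le> 2 * \<eta> ?n / r"
        by (rule logarithmic_derivative_small [OF _ _ close _ r]) (use Z N0 [OF n(2)] in auto)
      moreover have "1 / complex_of_real x = of_real t"
        by (simp add: x_def)
      ultimately have "norm D \<le> 2 * \<eta> ?n / r"
        by (simp only: D_def)
      moreover have "norm D / real (card {1..?n}) \<le> norm D / 1"
        using n by (intro divide_left_mono) auto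
      ultimately show ?thesis
        unfolding D_def [symmetric] norm_divide norm_of_nat by linarith
    qed
    have null: "(\<lambda>n. 2 * \<eta> (n + N) / r) \<longlonglongrightarrow> 0"
      using tendsto_mult_left [OF LIMSEQ_ignore_initial_segment [OF \<eta>0, of N], of "2 / r"] by simp
    show "(\<lambda>n. ((\<Sum>j\<in>{1..n + N}. of_real t / (1 - of_real t / z (n + N) j))
        - of_real (a (n + N))) / of_nat (card {1..n + N})) \<longlonglongrightarrow> 0"
      by (rule Lim_null_comparison [OF always_eventually [OF allI [OF bound]] null])
  qed (use R in auto)
qed

end
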